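(* Let $\omega$ be a slow majorant and let $p\in[1,\infty]$. If $\varphi\in\Lambda_{\omega,p}(\mathbb{T})$ and $\varphi$ is continuous on $\mathbb{T}$, then $P[\varphi]\in\Lambda_{\omega,p}(\overline{\mathbb{D}})$.
   Context: $\mathbb{D}$ is the open unit disk in $\mathbb{C}$ and $\mathbb{T}=\partial\mathbb{D}$. A majorant is a continuous increasing function $\omega:[0,\infty)\to[0,\infty)$ with $\omega(0)=0$ such that $\omega(t)/t$ is non-increasing for $t>0$. It is slow if, for some $\delta_0>0$ and $M>0$, $\delta\int_\delta^\infty\frac{\omega(t)}{t^2}\,dt\le M\omega(\delta)$ for all $0<\delta<\delta_0$. For $p\in(0,\infty)$ put $\mathcal{L}_p[F](z_1,z_2)=\left(\int_0^{2\pi}|F(e^{i\eta}z_1)-F(e^{i\eta}z_2)|^p\,d\eta\right)^{1/p}$, and $\mathcal{L}_\infty[F](z_1,z_2)=|F(z_1)-F(z_2)|$. $\Lambda_{\omega,p}(\mathbb{T})$ consists of those $F\in L^p(\mathbb{T})$ for which there is $M>0$ with $\mathcal{L}_p[F](\xi_1,\xi_2)\le M\omega(|\xi_1-\xi_2|)$ for all $\xi_1,\xi_2\in\mathbb{T}$. $\Lambda_{\omega,p}(\overline{\mathbb{D}})$ is the class of Borel functions $F:\overline{\mathbb{D}}\to\mathbb{C}$ for which there is $M>0$ with $\mathcal{L}_p[F](z_1,z_2)\le M\omega(|z_1-z_2|)$ for all $z_1,z_2\in\overline{\mathbb{D}}$. $P[\varphi](z)=\frac1{2\pi}\int_0^{2\pi}\varphi(e^{i\tau})\frac{1-|z|^2}{|e^{i\tau}-z|^2}\,d\tau$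 for $z\in\mathbb{D}$ is the Poisson integral; for continuous $\varphi$ it is extended to $\mathbb{T}$ by $P[\varphi]=\varphi$. *)

theory Defs
  imports "HOL-Analysis.Analysis"
begin

text \<open>Functions on \<open>[0,\<infinity>)\<close>, on the unit circle and on the closed unit disk are total functions
  of which only the values on \<open>{0..}\<close>, \<open>sphere 0 1\<close> and \<open>cball 0 1\<close> respectively are
  relevant.  ``Increasing'' is understood in the non-strict sense.\<close>

definition majorant :: "(real \<Rightarrow> real) \<Rightarrow> bool" where
  "majorant \<omega> \<longleftrightarrow>
     continuous_on {0..} \<omega> \<and> mono_on {0..} \<omega> \<and> (\<forall>t\<ge>0. 0 \<le> \<omega> t) \<and> \<omega> 0 = 0 \<and>
     antimono_on {0<..} (\<lambda>t. \<omega> t / t)"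

text \<open>The integral is taken in \<open>[0,\<infinity>]\<close>, so the inequality includes its convergence.\<close>

definition slow_majorant :: "(real \<Rightarrow> real) \<Rightarrow> bool" where
  "slow_majorant \<omega> \<longleftrightarrow>
     majorant \<omega> \<and>
     (\<exists>\<delta>\<^sub>0>0. \<exists>M>0. \<forall>\<delta>. 0 < \<delta> \<and> \<delta> < \<delta>\<^sub>0 \<longrightarrow>
        ennreal \<delta> * (\<integral>\<^sup>+ t \<in> {\<delta>..}. ennreal (\<omega> t / t\<^sup>2) \<partial>lborel) \<le> ennreal (M * \<omega> \<delta>))"

definition ennreal_powr :: "ennreal \<Rightarrow> real \<Rightarrow> ennreal" where
  "ennreal_powr x a = (if x = \<infinity> then \<infinity> else ennreal (enn2real x powr a))"

text \<open>The exponent \<open>p\<close> ranges over \<open>(0,\<infinity>]\<close>.  The value of \<open>Lp_diff\<close> may be infinite;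
  for \<open>p = \<infinity>\<close> it is the pointwise difference, with no supremum over rotations.\<close>

definition Lp_diff :: "ennreal \<Rightarrow> (complex \<Rightarrow> complex) \<Rightarrow> complex \<Rightarrow> complex \<Rightarrow> ennreal" where
  "Lp_diff p F z\<^sub>1 z\<^sub>2 =
     (if p = \<infinity> then ennreal (norm (F z\<^sub>1 - F z\<^sub>2))
      else ennreal_powr
        (\<integral>\<^sup>+ \<eta>. ennreal (norm (F (cis \<eta> * z\<^sub>1) - F (cis \<eta> * z\<^sub>2)) powr enn2real p)
           \<partial>(lebesgue_on {0..2*pi}))
        (1 / enn2real p))"

definition Lp_circle :: "ennreal \<Rightarrow> (complex \<Rightarrow> complex) set" where
  "Lp_circle p = {F. (\<lambda>\<eta>. F (cis \<eta>)) \<in> borel_measurable (lebesgue_on {0..2*pi}) \<and>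
     (if p = \<infinity> then \<exists>C. AE \<eta> in lebesgue_on {0..2*pi}. norm (F (cis \<eta>)) \<le> C
      else (\<integral>\<^sup>+ \<eta>. ennreal (norm (F (cis \<eta>)) powr enn2real p) \<partial>(lebesgue_on {0..2*pi})) < \<infinity>)}"

definition Lambda_circle :: "(real \<Rightarrow> real) \<Rightarrow> ennreal \<Rightarrow> (complex \<Rightarrow> complex) set" where
  "Lambda_circle \<omega> p = {F \<in> Lp_circle p. \<exists>M>0. \<forall>\<xi>\<^sub>1\<in>sphere 0 1. \<forall>\<xi>\<^sub>2\<in>sphere 0 1.
     Lp_diff p F \<xi>\<^sub>1 \<xi>\<^sub>2 \<le> ennreal (M * \<omega> (norm (\<xi>\<^sub>1 - \<xi>\<^sub>2)))}"

definition Lambda_disk :: "(real \<Rightarrow> real) \<Rightarrow> ennreal \<Rightarrow> (complex \<Rightarrow> complex) set" where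
  "Lambda_disk \<omega> p = {F \<in> borel_measurable (restrict_space borel (cball 0 1)).
     \<exists>M>0. \<forall>z\<^sub>1\<in>cball 0 1. \<forall>z\<^sub>2\<in>cball 0 1.
     Lp_diff p F z\<^sub>1 z\<^sub>2 \<le> ennreal (M * \<omega> (norm (z\<^sub>1 - z\<^sub>2)))}"

definition poisson_integral :: "(complex \<Rightarrow> complex) \<Rightarrow> complex \<Rightarrow> complex" where
  "poisson_integral \<phi> z = complex_of_real (1 / (2 * pi)) *
     (\<integral>\<tau>. \<phi> (cis \<tau>) * complex_of_real ((1 - (norm z)\<^sup>2) / (norm (cis \<tau> - z))\<^sup>2)
        \<partial>(lebesgue_on {0..2*pi}))"

definition poisson_extension :: "(complex \<Rightarrow> complex) \<Rightarrow> complex \<Rightarrow> complex" where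
  "poisson_extension \<phi> z = (if z \<in> ball 0 1 then poisson_integral \<phi> z else \<phi> z)"

end

theory Submission
  imports Defs "HOL-Complex_Analysis.Cauchy_Integral_Formula"
begin

text \<open>Write \<open>F\<close> for the extension and measure differences of \<open>F\<close> and \<open>\<phi>\<close> by their mean over rotations
  (pointwise if \<open>p = \<infinity>\<close>).  A rotation acts on a Poisson integral by rotating the boundary values, the kernel being
  unchanged.  Hence every difference of values of \<open>F\<close>, one of them at an interior point, is
  an integral of differences
  \<open>\<phi> (cis t) - \<phi> \<zeta>\<close> against a kernel independent of the rotation, and Minkowski's integral inequality
  (\<open>Lp_diff_le_integral\<close>) replaces the differences of \<open>\<phi>\<close> by the modulus \<open>\<omega> (norm (cis t - \<zeta>))\<close>.
  What is left is an estimate of kernel integrals in which \<open>p\<close> no longer occurs.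

  Let \<open>\<zeta>\<close> be the boundary point nearest to \<open>z\<close>, \<open>\<delta> = 1 - norm z\<close> and \<open>s = norm (cis t - \<zeta>)\<close>.
  The Poisson kernel of \<open>z\<close> is at most \<open>2 \<delta> / (max \<delta> (s/2))\<^sup>2\<close>.  If \<open>d = norm (z - z')\<close> is at most \<open>\<delta> / 2\<close>,
  the kernels of \<open>z\<close> and \<open>z'\<close> differ by at most \<open>4 d / (max \<delta> (s/2))\<^sup>2\<close>.  In both cases the cut-off
  may be lowered to the distance \<open>d\<close> under consideration (\<open>d = \<delta>\<close> in the first case), and the
  integral of \<open>\<omega> s / (max d (s/2))\<^sup>2\<close> over the circle is at most a constant times \<open>\<omega> d / d\<close>: the part
  with \<open>s\<close> below \<open>d\<close> is trivial, and the rest is the tail integral bounded by slowness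
  (\<open>integral_majorant_circle_le\<close>).  This is \<open>Lp_diff_poisson_le_kernel\<close>.  It bounds the
  difference of \<open>F\<close> between \<open>z\<close> and \<open>\<zeta>\<close> by a multiple of \<open>\<omega> \<delta>\<close>, and that between \<open>z\<close> and a close
  \<open>z'\<close> by a multiple of \<open>\<omega> d\<close>.

  If two points are not close compared with the depth of the first, both depths and the distance
  of the nearest boundary points are at most multiples of \<open>d\<close>.  The path from \<open>z\<close> out to the circle,
  along the circle and back in to \<open>z'\<close> then gives the estimate, since \<open>\<omega> (c d)\<close> is at most \<open>c \<omega> d\<close>
  for \<open>c \<ge> 1\<close>.\<close>

section \<open>Minkowski's integral inequality\<close>

text \<open>Convexity of \<open>x powr p\<close>, in the form of Young's inequality with weights \<open>1/p\<close> and \<open>(p - 1)/p\<close>.\<close>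

lemma powr_tangent_le:
  fixes p t x :: real
  assumes "p \<ge> 1" "t > 0" "x \<ge> 0"
  shows "p * t powr (p - 1) * x \<le> x powr p + (p - 1) * t powr p"
proof (cases "x = 0")
  case False
  with assms have x: "x > 0" by simp
  have "(x powr p) powr (1/p) * (t powr p) powr ((p - 1)/p)
      \<le> 1/p * x powr p + (p - 1)/p * t powr p"
    using assms x by (intro Youngs_inequality_0) (auto simp: field_simps)
  then have "x * t powr (p - 1) \<le> 1/p * x powr p + (p - 1)/p * t powr p"
    using assms x by (simp add: powr_powr)
  then show ?thesis using assms by (simp add: field_simps)
qed (use assms in auto)

lemma continuous_on_section:
  assumes "continuous_on UNIV (\<lambda>(x, y). g x y)"
  shows "continuous_on S (\<lambda>y. g x y)"
proof -
  have "continuous_on S ((\<lambda>(x, y). g x y) \<circ> (\<lambda>y. (x, y)))"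
    by (intro continuous_on_compose continuous_intros continuous_on_subset[OF assms]) auto
  then show ?thesis by (simp add: o_def)
qed

text \<open>Jensen's inequality for the measure with density \<open>k w\<close> and the function \<open>g / w\<close>.  That measure
need not have mass one, and \<open>W\<close> may be any upper bound of its mass: the tangent line of
\<open>x powr p\<close> at \<open>A / W\<close>, where \<open>A\<close> is the integral of \<open>k g\<close>, is integrated against it.\<close>

lemma Jensen_powr_weighted:
  fixes g k w :: "real \<Rightarrow> real" and p W a b :: real
  assumes p: "p \<ge> 1"
    and g: "continuous_on {a..b} g" "\<And>t. g t \<ge> 0"
    and k: "continuous_on {a..b} k" "\<And>t. k t \<ge> 0"
    and w: "continuous_on {a..b} w" "\<And>t. w t > 0"
    and W: "integral {a..b} (\<lambda>t. k t * w t) \<le> W" "W > 0"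
  shows "(integral {a..b} (\<lambda>t. k t * g t)) powr p
    \<le> W powr (p - 1) * integral {a..b} (\<lambda>t. k t * w t powr (1 - p) * g t powr p)"
    (is "?A powr p \<le> _ * ?B")
proof -
  have w0: "w t \<noteq> 0" for t using w(2)[of t] by simp
  have cB: "continuous_on {a..b} (\<lambda>t. k t * w t powr (1 - p) * g t powr p)"
    using p by (intro continuous_intros continuous_on_powr' g k w) (auto simp: w0 g less_imp_le[OF w(2)])
  have B: "?B \<ge> 0" by (intro integral_nonneg integrable_continuous_interval cB) (auto simp: k)
  have A: "?A \<ge> 0"
    by (intro integral_nonneg integrable_continuous_interval continuous_intros g k) (auto simp: g k)
  show ?thesis
  proof (cases "?A = 0")
    case False
    define t where "t = ?A / W"
    have t: "t > 0" using A False W by (simp add: t_def)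
    \<comment> \<open>The tangent line at \<open>t\<close>, evaluated at \<open>g s / w s\<close> and multiplied by the density.\<close>
    have pw: "p * t powr (p - 1) * (k s * g s)
        \<le> k s * w s powr (1 - p) * g s powr p + (p - 1) * t powr p * (k s * w s)" for s
    proof -
      have "p * t powr (p - 1) * (g s / w s) \<le> (g s / w s) powr p + (p - 1) * t powr p"
        using p t g(2)[of s] w(2)[of s] by (intro powr_tangent_le) auto
      then have "(k s * w s) * (p * t powr (p - 1) * (g s / w s))
          \<le> (k s * w s) * ((g s / w s) powr p + (p - 1) * t powr p)"
        using k(2)[of s] w(2)[of s] by (intro mult_left_mono) auto
      moreover have "w s * (g s / w s) powr p = w s powr (1 - p) * g s powr p"
        using w(2)[of s] g(2)[of s] by (simp add: powr_divide powr_diff)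
      ultimately show ?thesis using w(2)[of s] by (simp add: algebra_simps)
    qed
    have "p * t powr (p - 1) * ?A = integral {a..b} (\<lambda>s. p * t powr (p - 1) * (k s * g s))"
      by simp
    also have "\<dots> \<le> integral {a..b} (\<lambda>s. k s * w s powr (1 - p) * g s powr p
         + (p - 1) * t powr p * (k s * w s))"
      by (intro integral_le integrable_continuous_interval continuous_intros cB g k w pw)
    also have "\<dots> = ?B + (p - 1) * t powr p * integral {a..b} (\<lambda>s. k s * w s)"
      by (subst integral_add)
        (auto intro!: integrable_continuous_interval continuous_intros cB g k w)
    also have "\<dots> \<le> ?B + (p - 1) * t powr p * W"
      using W p by (intro add_left_mono mult_left_mono) auto
    finally have 1: "p * t powr (p - 1) * ?A \<le> ?B + (p - 1) * t powr p * W" .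
    have "t powr (p - 1) * ?A = t powr p * W"
      using t W by (simp add: t_def powr_diff field_simps)
    with 1 have "t powr p * W \<le> ?B" by (simp add: algebra_simps)
    then have "W powr (p - 1) * (t powr p * W) \<le> W powr (p - 1) * ?B"
      by (intro mult_left_mono) auto
    moreover have "W powr (p - 1) * (t powr p * W) = ?A powr p"
    proof -
      have "W powr (p - 1) * W = W powr p" using W by (simp add: powr_diff)
      moreover have "t powr p = ?A powr p / W powr p" unfolding t_def by (rule powr_divide)
      moreover have "W powr (p - 1) * (t powr p * W) = t powr p * (W powr (p - 1) * W)"
        by (simp only: mult_ac)
      ultimately show ?thesis using W by simp
    qed
    ultimately show ?thesis by simp
  qed (use B in simp)
qed

lemma nn_integral_lebesgue_on_borel:
  "(\<integral>\<^sup>+x. f x \<partial>lebesgue_on {a..b::real}) = (\<integral>\<^sup>+x. f x * indicator {a..b} x \<partial>lborel)"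
  by (subst nn_integral_restrict_space) (auto simp: nn_integral_completion)

text \<open>If the slice \<open>g x t\<close> has norm at most \<open>w t\<close> in the variable \<open>x\<close>, the average of the slices with
density \<open>k\<close> has norm at most the average of \<open>w\<close>.  Weighting the slices by \<open>1 / w\<close> makes all their
norms at most one; Jensen's inequality bounds the \<open>p\<close>-th power of the average pointwise in \<open>x\<close>,
and Tonelli's theorem integrates this bound over \<open>x\<close> slice by slice.\<close>

lemma Minkowski_integral_inequality_pos:
  fixes g :: "real \<Rightarrow> real \<Rightarrow> real" and k w :: "real \<Rightarrow> real" and p W a b :: real
  assumes p: "p \<ge> 1"
    and g: "continuous_on UNIV (\<lambda>(x, t). g x t)" "\<And>x t. g x t \<ge> 0"
    and k: "continuous_on UNIV k" "\<And>t. k t \<ge> 0"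
    and w: "continuous_on UNIV w" "\<And>t. w t > 0"
    and W: "integral {a..b} (\<lambda>t. k t * w t) \<le> W" "W > 0"
    and le: "\<And>t. (\<integral>\<^sup>+x. ennreal (g x t powr p) \<partial>lebesgue_on {c..d}) \<le> ennreal (w t powr p)"
  shows "(\<integral>\<^sup>+x. ennreal ((integral {a..b} (\<lambda>t. k t * g x t)) powr p) \<partial>lebesgue_on {c..d})
    \<le> ennreal (W powr p)"
proof -
  have w0: "w t \<noteq> 0" for t using w(2)[of t] by simp
  have sub: "continuous_on S f" if "continuous_on UNIV f" for S and f :: "real \<Rightarrow> real"
    using that continuous_on_subset by blast
  have [measurable]: "k \<in> borel_measurable borel" "w \<in> borel_measurable borel"
    "(\<lambda>(x, t). g x t) \<in> borel_measurable borel"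
    using g k w by (auto intro: borel_measurable_continuous_onI)
  then have gm: "(\<lambda>(x, t). g x t) \<in> borel_measurable (lborel \<Otimes>\<^sub>M lborel)"
    by (simp add: lborel_prod)
  note gm' = gm[unfolded split_beta']
  define h where "h x t = k t * w t powr (1 - p) * g x t powr p" for x t
  have h0: "h x t \<ge> 0" for x t by (auto simp: h_def k)
  have ch: "continuous_on {a..b} (h x)" for x
    unfolding h_def using p
    by (intro continuous_intros continuous_on_powr' sub[OF k(1)] sub[OF w(1)] continuous_on_section[OF g(1)])
       (auto simp: w0 g less_imp_le[OF w(2)])
  have "(\<integral>\<^sup>+x. (\<integral>\<^sup>+t. ennreal (h x t) * indicator {a..b} t * indicator {c..d} x \<partial>lborel) \<partial>lborel)
     = (\<integral>\<^sup>+t. (\<integral>\<^sup>+x. ennreal (h x t) * indicator {a..b} t * indicator {c..d} x \<partial>lborel) \<partial>lborel)"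
  proof -
    have "(\<lambda>(t, x). g x t) \<in> borel_measurable (lborel \<Otimes>\<^sub>M lborel)"
      using measurable_pair_swap[OF gm] by simp
    note [measurable] = this[unfolded split_beta' measurable_lborel1]
    show ?thesis unfolding h_def by (intro lborel_pair.Fubini') measurable
  qed
  also have "\<dots> \<le> (\<integral>\<^sup>+t. ennreal (k t * w t) * indicator {a..b} t \<partial>lborel)"
  proof (rule nn_integral_mono)
    fix t :: real
    have [measurable]: "(\<lambda>x. g x t) \<in> borel_measurable borel" using gm by measurable
    have "(\<integral>\<^sup>+x. ennreal (h x t) * indicator {a..b} t * indicator {c..d} x \<partial>lborel)
       = (\<integral>\<^sup>+x. (ennreal (k t * w t powr (1 - p)) * indicator {a..b} t) *
           (ennreal (g x t powr p) * indicator {c..d} x) \<partial>lborel)"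
      by (intro nn_integral_cong) (simp add: h_def ennreal_mult k mult_ac)
    also have "\<dots> = ennreal (k t * w t powr (1 - p)) * indicator {a..b} t *
        (\<integral>\<^sup>+x. ennreal (g x t powr p) \<partial>lebesgue_on {c..d})"
      unfolding nn_integral_lebesgue_on_borel by (intro nn_integral_cmult) measurable
    also have "\<dots> \<le> ennreal (k t * w t powr (1 - p)) * indicator {a..b} t * ennreal (w t powr p)"
      by (intro mult_left_mono le) auto
    also have "\<dots> = ennreal (k t * w t) * indicator {a..b} t"
      using w(2)[of t] k(2)[of t]
      by (cases "t \<in> {a..b}") (simp_all add: powr_diff flip: ennreal_mult)
    finally show "(\<integral>\<^sup>+x. ennreal (h x t) * indicator {a..b} t * indicator {c..d} x \<partial>lborel)
       \<le> ennreal (k t * w t) * indicator {a..b} t" .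
  qed
  also have "\<dots> = ennreal (integral {a..b} (\<lambda>t. k t * w t))"
    using k w by (intro nn_integral_has_integral_lebesgue' integrable_integral integrable_continuous_interval continuous_intros
      sub[OF k(1)] sub[OF w(1)])
       (simp add: less_imp_le)
  also have "\<dots> \<le> ennreal W" using W by (intro ennreal_leI)
  finally have swap: "(\<integral>\<^sup>+x. (\<integral>\<^sup>+t. ennreal (h x t) * indicator {a..b} t * indicator {c..d} x \<partial>lborel) \<partial>lborel)
    \<le> ennreal W" .
  have "(\<integral>\<^sup>+x. ennreal ((integral {a..b} (\<lambda>t. k t * g x t)) powr p) \<partial>lebesgue_on {c..d})
     \<le> (\<integral>\<^sup>+x. ennreal (W powr (p - 1)) *
          (\<integral>\<^sup>+t. ennreal (h x t) * indicator {a..b} t \<partial>lborel) \<partial>lebesgue_on {c..d})"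
  proof (rule nn_integral_mono)
    fix x
    have "(integral {a..b} (\<lambda>t. k t * g x t)) powr p \<le> W powr (p - 1) * integral {a..b} (h x)"
      unfolding h_def
      by (intro Jensen_powr_weighted p g k w W sub[OF k(1)] sub[OF w(1)] continuous_on_section[OF g(1)])
    moreover have "(\<integral>\<^sup>+t. ennreal (h x t) * indicator {a..b} t \<partial>lborel) = ennreal (integral {a..b} (h x))"
      by (intro nn_integral_has_integral_lebesgue' integrable_integral integrable_continuous_interval ch h0)
    ultimately show "ennreal ((integral {a..b} (\<lambda>t. k t * g x t)) powr p)
      \<le> ennreal (W powr (p - 1)) * (\<integral>\<^sup>+t. ennreal (h x t) * indicator {a..b} t \<partial>lborel)"
      by (metis ennreal_leI ennreal_mult' powr_ge_zero)
  qed
  also have "\<dots> = ennreal (W powr (p - 1)) * 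
      (\<integral>\<^sup>+x. (\<integral>\<^sup>+t. ennreal (h x t) * indicator {a..b} t * indicator {c..d} x \<partial>lborel) \<partial>lborel)"
  proof -
    have "(\<integral>\<^sup>+t. ennreal (h x t) * indicator {a..b} t * indicator {c..d} x \<partial>lborel)
      = (\<integral>\<^sup>+t. ennreal (h x t) * indicator {a..b} t \<partial>lborel) * indicator {c..d} x" for x
    proof -
      have [measurable]: "g x \<in> borel_measurable borel"
        by (intro borel_measurable_continuous_onI continuous_on_section[OF g(1)])
      show ?thesis unfolding h_def by (intro nn_integral_multc) measurable
    qed
    moreover have "(\<lambda>x. (\<integral>\<^sup>+t. ennreal (h x t) * indicator {a..b} t \<partial>lborel) * indicator {c..d} x)
        \<in> borel_measurable lborel"
      unfolding h_def using gm' by measurable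
    ultimately show ?thesis
      unfolding nn_integral_lebesgue_on_borel by (simp add: nn_integral_cmult mult.assoc)
  qed
  also have "\<dots> \<le> ennreal (W powr (p - 1)) * ennreal W"
    by (intro mult_left_mono swap) auto
  also have "\<dots> = ennreal (W powr p)"
    using W by (simp add: powr_diff flip: ennreal_mult)
  finally show ?thesis .
qed

text \<open>The bound \<open>w\<close> may vanish, as the modulus of continuity at distance zero does.  The positive
case is applied to \<open>w + e\<close>, and \<open>e\<close> tends to zero.\<close>

lemma Minkowski_integral_inequality:
  fixes g :: "real \<Rightarrow> real \<Rightarrow> real" and k w :: "real \<Rightarrow> real" and p a b :: real
  assumes p: "p \<ge> 1"
    and g: "continuous_on UNIV (\<lambda>(x, t). g x t)" "\<And>x t. g x t \<ge> 0"
    and k: "continuous_on UNIV k" "\<And>t. k t \<ge> 0"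
    and w: "continuous_on UNIV w" "\<And>t. w t \<ge> 0"
    and le: "\<And>t. (\<integral>\<^sup>+x. ennreal (g x t powr p) \<partial>lebesgue_on {c..d}) \<le> ennreal (w t powr p)"
  shows "(\<integral>\<^sup>+x. ennreal ((integral {a..b} (\<lambda>t. k t * g x t)) powr p) \<partial>lebesgue_on {c..d})
    \<le> ennreal ((integral {a..b} (\<lambda>t. k t * w t)) powr p)"
    (is "?L \<le> ennreal (?I powr p)")
proof -
  have sub: "continuous_on S f" if "continuous_on UNIV f" for S and f :: "real \<Rightarrow> real"
    using that continuous_on_subset by blast
  have int: "(\<lambda>t. k t * w t) integrable_on {a..b}" "k integrable_on {a..b}"
      "(\<lambda>t. e * k t) integrable_on {a..b}" for e
    by (intro integrable_continuous_interval continuous_intros sub[OF k(1)] sub[OF w(1)])+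
  have I: "?I \<ge> 0" by (intro integral_nonneg int) (auto simp: k w)
  have K: "integral {a..b} k \<ge> 0" by (intro integral_nonneg int) (auto simp: k)
  \<comment> \<open>The summand \<open>1\<close> keeps the upper bound positive even when \<open>k\<close> is identically zero.\<close>
  have eps: "?L \<le> ennreal ((?I + e * (integral {a..b} k + 1)) powr p)" if e: "e > 0" for e
  proof (rule Minkowski_integral_inequality_pos[OF p g k, where w = "\<lambda>t. w t + e"])
    have "integral {a..b} (\<lambda>t. k t * (w t + e)) = integral {a..b} (\<lambda>t. k t * w t + e * k t)"
      by (simp add: algebra_simps)
    also have "\<dots> = ?I + e * integral {a..b} k"
      by (subst integral_add) (use int in auto)
    finally show "integral {a..b} (\<lambda>t. k t * (w t + e)) \<le> ?I + e * (integral {a..b} k + 1)"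
      using e by (simp add: algebra_simps)
    show "?I + e * (integral {a..b} k + 1) > 0" using I K e by (simp add: add_nonneg_pos)
    show "(\<integral>\<^sup>+x. ennreal (g x t powr p) \<partial>lebesgue_on {c..d}) \<le> ennreal ((w t + e) powr p)" for t
      using w(2)[of t] e p by (intro order_trans[OF le] ennreal_leI powr_mono2) auto
  qed (use w e in \<open>auto intro!: continuous_intros add_nonneg_pos\<close>)
  have "((\<lambda>e. ennreal ((?I + e * (integral {a..b} k + 1)) powr p)) \<longlongrightarrow>
      ennreal ((?I + 0 * (integral {a..b} k + 1)) powr p)) (at_right 0)"
    using p I K by (intro tendsto_ennrealI tendsto_powr' tendsto_intros)
      (auto simp: eventually_at_filter intro!: always_eventually)
  from tendsto_lowerbound[OF this, of ?L] show ?thesis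
    by (auto simp: eventually_at_filter eps)
qed

section \<open>The mean difference over rotations\<close>

lemma ennreal_powr_le_iff:
  assumes "p > 0" "A \<ge> 0"
  shows "ennreal_powr x (1 / p) \<le> ennreal A \<longleftrightarrow> x \<le> ennreal (A powr p)"
proof (cases x)
  case (real r)
  have "r powr (1 / p) \<le> A \<longleftrightarrow> (r powr (1 / p)) powr p \<le> A powr p"
    using assms by (auto intro: powr_mono2 dest: powr_less_mono2 simp: not_le[symmetric])
       (meson not_le powr_ge_zero powr_less_mono2)
  then show ?thesis using real assms by (simp add: ennreal_powr_def powr_powr ennreal_le_iff)
qed (auto simp: ennreal_powr_def top_unique)

lemma Lp_diff_infinity_le_iff:
  "A \<ge> 0 \<Longrightarrow> Lp_diff top F x y \<le> ennreal A \<longleftrightarrow> norm (F x - F y) \<le> A"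
  by (simp add: Lp_diff_def)

lemma enn2real_ge_1: "1 \<le> p \<Longrightarrow> p \<noteq> top \<Longrightarrow> 1 \<le> enn2real p"
  using enn2real_mono[of 1 p] by (simp add: less_top)

lemma Lp_diff_finite_le_iff:
  assumes "1 \<le> p" "p \<noteq> top" "A \<ge> 0"
  shows "Lp_diff p F x y \<le> ennreal A \<longleftrightarrow>
    (\<integral>\<^sup>+\<eta>. ennreal (norm (F (cis \<eta> * x) - F (cis \<eta> * y)) powr enn2real p)
       \<partial>lebesgue_on {0..2*pi}) \<le> ennreal (A powr enn2real p)"
  using assms enn2real_ge_1[of p]
  by (simp add: Lp_diff_def ennreal_powr_le_iff)

lemma Lp_diff_refl: "1 \<le> p \<Longrightarrow> Lp_diff p F x x = 0"
  using Lp_diff_finite_le_iff[of p 0 F x x] by (cases "p = top") (simp_all add: Lp_diff_def)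

lemma Lp_diff_commute: "Lp_diff p F x y = Lp_diff p F y x"
  by (simp add: Lp_diff_def norm_minus_commute)

lemma Lp_diff_mono: "Lp_diff p F x y \<le> ennreal A \<Longrightarrow> A \<le> B \<Longrightarrow> Lp_diff p F x y \<le> ennreal B"
  by (meson ennreal_leI order_trans)

lemma borel_measurable_rotation:
  assumes F: "F \<in> borel_measurable (restrict_space borel (cball 0 1))" and z: "norm z \<le> 1"
  shows "(\<lambda>\<eta>. F (cis \<eta> * z)) \<in> borel_measurable (lebesgue_on S)"
proof -
  have "(\<lambda>\<eta>. cis \<eta> * z) \<in> borel_measurable borel"
    by (intro borel_measurable_continuous_onI continuous_intros)
  then have "(\<lambda>\<eta>. cis \<eta> * z) \<in> borel \<rightarrow>\<^sub>M restrict_space borel (cball 0 1)"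
    using z by (intro measurable_restrict_space2) (auto simp: norm_mult)
  then have "(\<lambda>\<eta>. F (cis \<eta> * z)) \<in> borel_measurable borel"
    using F by (rule measurable_compose)
  then show ?thesis
    by (intro measurable_restrict_space1 measurable_completion) simp
qed

text \<open>A quasi-triangle inequality with a crude constant suffices for the modulus estimate, and it only
uses \<open>\<bar>a + b\<bar> \<le> 2 max \<bar>a\<bar> \<bar>b\<bar>\<close> pointwise.\<close>

lemma Lp_diff_triangle:
  assumes p: "1 \<le> p" and F: "F \<in> borel_measurable (restrict_space borel (cball 0 1))"
    and xyz: "norm x \<le> 1" "norm y \<le> 1" "norm z \<le> 1"
    and xy: "Lp_diff p F x y \<le> ennreal A" and yz: "Lp_diff p F y z \<le> ennreal B"
    and AB: "A \<ge> 0" "B \<ge> 0"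
  shows "Lp_diff p F x z \<le> ennreal (4 * (A + B))"
proof (cases "p = top")
  case True
  then show ?thesis using xy yz AB norm_triangle_ineq[of "F x - F y" "F y - F z"]
    by (simp add: Lp_diff_infinity_le_iff del: ennreal_plus)
next
  case False
  define q where "q = enn2real p"
  have q: "q \<ge> 1" unfolding q_def using p False by (rule enn2real_ge_1)
  let ?u = "\<lambda>\<eta>. norm (F (cis \<eta> * x) - F (cis \<eta> * y)) powr q"
  let ?v = "\<lambda>\<eta>. norm (F (cis \<eta> * y) - F (cis \<eta> * z)) powr q"
  note [measurable] = xyz[THEN borel_measurable_rotation[OF F]]
  have "(\<integral>\<^sup>+\<eta>. ennreal (norm (F (cis \<eta> * x) - F (cis \<eta> * z)) powr q) \<partial>lebesgue_on {0..2*pi})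
    \<le> (\<integral>\<^sup>+\<eta>. ennreal (2 powr q) * (ennreal (?u \<eta>) + ennreal (?v \<eta>)) \<partial>lebesgue_on {0..2*pi})"
  proof (rule nn_integral_mono)
    fix \<eta>
    let ?a = "norm (F (cis \<eta> * x) - F (cis \<eta> * y))" and ?b = "norm (F (cis \<eta> * y) - F (cis \<eta> * z))"
    have "norm (F (cis \<eta> * x) - F (cis \<eta> * z)) powr q \<le> (2 * max ?a ?b) powr q"
      using q norm_triangle_ineq[of "F (cis \<eta> * x) - F (cis \<eta> * y)" "F (cis \<eta> * y) - F (cis \<eta> * z)"]
      by (intro powr_mono2) auto
    also have "\<dots> \<le> 2 powr q * (?a powr q + ?b powr q)"
      by (auto simp: powr_mult max_def intro!: mult_left_mono)
    finally show "ennreal (norm (F (cis \<eta> * x) - F (cis \<eta> * z)) powr q)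
      \<le> ennreal (2 powr q) * (ennreal (?u \<eta>) + ennreal (?v \<eta>))"
      by (simp add: ennreal_leI flip: ennreal_mult ennreal_plus)
  qed
  also have "\<dots> = ennreal (2 powr q) *
      ((\<integral>\<^sup>+\<eta>. ennreal (?u \<eta>) \<partial>lebesgue_on {0..2*pi}) + (\<integral>\<^sup>+\<eta>. ennreal (?v \<eta>) \<partial>lebesgue_on {0..2*pi}))"
    by (subst nn_integral_cmult) (simp_all add: nn_integral_add)
  also have "\<dots> \<le> ennreal (2 powr q) * (ennreal (A powr q) + ennreal (B powr q))"
    using xy yz p False AB by (intro mult_left_mono add_mono) (auto simp: Lp_diff_finite_le_iff q_def)
  also have "\<dots> = ennreal (2 powr q * (A powr q + B powr q))"
    by (simp flip: ennreal_mult ennreal_plus)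
  also have "\<dots> \<le> ennreal ((4 * (A + B)) powr q)"
  proof (rule ennreal_leI)
    have "A powr q + B powr q \<le> (A + B) powr q + (A + B) powr q"
      using AB q by (intro add_mono powr_mono2) auto
    also have "\<dots> \<le> 2 powr q * (A + B) powr q"
      using powr_mono[OF q, of 2] mult_right_mono[of 2 "2 powr q" "(A + B) powr q"] by simp
    finally have "2 powr q * (A powr q + B powr q) \<le> 2 powr q * (2 powr q * (A + B) powr q)"
      by (intro mult_left_mono) auto
    also have "\<dots> = (4 * (A + B)) powr q"
      using AB powr_mult[of 2 "2 * (A + B)" q] powr_mult[of 2 "A + B" q] by simp
    finally show "2 powr q * (A powr q + B powr q) \<le> (4 * (A + B)) powr q" .
  qed
  finally show ?thesis using p False AB by (simp add: Lp_diff_finite_le_iff q_def del: ennreal_plus)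
qed

text \<open>Minkowski's inequality for the mean difference.  For finite \<open>p\<close> the mean is taken over the
rotation angle; for \<open>p = \<infinity>\<close> there is no mean, and the triangle inequality for integrals at a single
point takes its place.\<close>

lemma Lp_diff_le_integral:
  fixes k w :: "real \<Rightarrow> real"
  assumes p: "1 \<le> p" and \<phi>: "continuous_on (sphere 0 1) \<phi>" and \<zeta>: "norm \<zeta> = 1"
    and k: "continuous_on UNIV k" "\<And>t. k t \<ge> 0"
    and w: "continuous_on UNIV w" "\<And>t. w t \<ge> 0"
    and le: "\<And>t. Lp_diff p \<phi> (cis t) \<zeta> \<le> ennreal (w t)"
    and F: "\<And>\<eta>. norm (F (cis \<eta> * x) - F (cis \<eta> * y))
      \<le> integral {0..2*pi} (\<lambda>t. k t * norm (\<phi> (cis \<eta> * cis t) - \<phi> (cis \<eta> * \<zeta>)))"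
  shows "Lp_diff p F x y \<le> ennreal (integral {0..2*pi} (\<lambda>t. k t * w t))" (is "_ \<le> ennreal ?I")
proof -
  define g where "g \<eta> t = norm (\<phi> (cis \<eta> * cis t) - \<phi> (cis \<eta> * \<zeta>))" for \<eta> t
  have g: "continuous_on UNIV (\<lambda>(\<eta>, t). g \<eta> t)"
    unfolding g_def split_beta' using \<zeta>
    by (intro continuous_intros continuous_on_compose2[OF \<phi>]) (auto simp: norm_mult)
  have sub: "continuous_on S f" if "continuous_on UNIV f" for S and f :: "real \<Rightarrow> real"
    using that continuous_on_subset by blast
  have int: "(\<lambda>t. k t * w t) integrable_on {0..2*pi}" 
    by (intro integrable_continuous_interval continuous_intros sub[OF k(1)] sub[OF w(1)])
  have I: "?I \<ge> 0" by (intro integral_nonneg int) (auto simp: k w)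
  show ?thesis
  proof (cases "p = top")
    case True
    have "norm (F x - F y) \<le> integral {0..2*pi} (\<lambda>t. k t * g 0 t)"
      using F[of 0] by (simp add: g_def)
    also have "\<dots> \<le> ?I"
    proof (intro integral_le int mult_left_mono k)
      show "(\<lambda>t. k t * g 0 t) integrable_on {0..2*pi}"
        by (intro integrable_continuous_interval continuous_intros sub[OF k(1)] continuous_on_section[OF g])
      show "g 0 t \<le> w t" for t using le[of t] w(2)[of t] True
        by (simp add: g_def Lp_diff_infinity_le_iff)
    qed
    finally show ?thesis using True I by (simp add: Lp_diff_infinity_le_iff)
  next
    case False
    define q where "q = enn2real p"
    have q: "q \<ge> 1" unfolding q_def using p False by (rule enn2real_ge_1)
    have "(\<integral>\<^sup>+\<eta>. ennreal (norm (F (cis \<eta> * x) - F (cis \<eta> * y)) powr q) \<partial>lebesgue_on {0..2*pi})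
      \<le> (\<integral>\<^sup>+\<eta>. ennreal ((integral {0..2*pi} (\<lambda>t. k t * g \<eta> t)) powr q) \<partial>lebesgue_on {0..2*pi})"
      using F q by (intro nn_integral_mono ennreal_leI powr_mono2) (auto simp: g_def)
    also have "\<dots> \<le> ennreal (?I powr q)"
    proof (rule Minkowski_integral_inequality[OF q g _ k w])
      show "(\<integral>\<^sup>+\<eta>. ennreal (g \<eta> t powr q) \<partial>lebesgue_on {0..2*pi}) \<le> ennreal (w t powr q)" for t
        using le[of t] w(2)[of t] p False by (simp add: Lp_diff_finite_le_iff g_def q_def)
    qed (auto simp: g_def)
    finally show ?thesis using p False I by (simp add: Lp_diff_finite_le_iff q_def)
  qed
qed

section \<open>The Poisson kernel\<close>

text \<open>Shifts by at most one period exchange two pieces of equal integral; other shifts reduce to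
  these by periodicity of the integral as a function of the shift.\<close>

lemma integral_periodic_shift:
  fixes f :: "real \<Rightarrow> 'a::euclidean_space"
  assumes f: "continuous_on UNIV f" and per: "\<And>x. f (x + T) = f x" and T: "T \<ge> 0"
  shows "integral {0..T} (\<lambda>x. f (x + c)) = integral {0..T} f"
proof -
  define G where "G a = integral {0..T} (\<lambda>x. f (x + a))" for a
  have G: "G a = integral {a..a + T} f" for a
    unfolding G_def using integral_shift_real_ivl[of a a "a + T" f] by simp
  have int: "f integrable_on {a..b}" for a b
    by (intro integrable_continuous_interval continuous_on_subset[OF f]) auto
  have step: "integral {a..a + T} f = integral {b..b + T} f" if ab: "a \<le> b" "b \<le> a + T" for a b
  proof -
    have "integral {a..b} f = integral {a + T..b + T} f"
      using integral_shift_real_ivl[of "a + T" T "b + T" f] by (simp add: per)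
    moreover have "integral {a..b} f + integral {b..a + T} f = integral {a..a + T} f"
      "integral {b..a + T} f + integral {a + T..b + T} f = integral {b..b + T} f"
      using ab int by (auto intro!: Henstock_Kurzweil_Integration.integral_combine)
    ultimately show ?thesis by (metis add.commute)
  qed
  have G_per: "G (a + T) = G a" for a
    unfolding G_def by (simp add: per flip: add.assoc)
  show ?thesis
  proof (cases "T = 0")
    case False
    with T have T: "T > 0" by simp
    have G_nat: "G (a + of_nat n * T) = G a" for a n
    proof (induction n)
      case (Suc n)
      then show ?case using G_per[of "a + of_nat n * T"] by (simp add: algebra_simps)
    qed simp
    have G_int: "G (a + of_int m * T) = G a" for a m
    proof (cases m)
      case (neg n)
      then have "of_int m = - (of_nat (Suc n) :: real)"
        by (simp only: of_int_minus of_int_of_nat_eq)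
      then have "a + of_int m * T + of_nat (Suc n) * T = a" by (simp only:)
      then show ?thesis using G_nat[of "a + of_int m * T" "Suc n"] by metis
    qed (use G_nat in simp)
    define r where "r = c - of_int \<lfloor>c / T\<rfloor> * T"
    have "r \<ge> 0" "r \<le> T"
      using T floor_divide_lower[of T c] floor_divide_upper[of T c]
      by (auto simp: r_def algebra_simps)
    then have "G r = G 0" using step[of 0 r] by (simp add: G)
    moreover have "G r = G c" using G_int[of r "\<lfloor>c / T\<rfloor>"] by (simp add: r_def)
    ultimately show ?thesis by (simp add: G_def)
  qed auto
qed

definition poisson_kernel :: "complex \<Rightarrow> complex \<Rightarrow> real" where
  "poisson_kernel z u = (1 - (norm z)\<^sup>2) / (norm (u - z))\<^sup>2"

lemma poisson_kernel_nonneg: "norm z \<le> 1 \<Longrightarrow> poisson_kernel z u \<ge> 0"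
  by (simp add: poisson_kernel_def power_le_one)

text \<open>Up to an affine map, the kernel is the real part of a Cauchy kernel.  This reduces its total mass
to Cauchy's integral formula and its difference at two points to a resolvent identity.\<close>

lemma poisson_kernel_eq_Re:
  assumes "norm u = 1" "u \<noteq> z"
  shows "poisson_kernel z u = 2 * Re (u / (u - z)) - 1"
proof -
  have n: "(norm (u - z))\<^sup>2 \<noteq> 0" using assms by simp
  have "Re (u / (u - z)) = Re (u * cnj (u - z)) / (norm (u - z))\<^sup>2"
    by (subst complex_div_cnj) (simp only: Re_divide_of_real flip: of_real_power)
  moreover have "2 * Re (u * cnj (u - z)) - (norm (u - z))\<^sup>2 = 1 - (norm z)\<^sup>2"
  proof -
    have "(Re u)\<^sup>2 + (Im u)\<^sup>2 = 1" using assms(1) by (simp flip: cmod_power2)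
    then show ?thesis unfolding cmod_power2 by (simp add: power2_eq_square algebra_simps)
  qed
  ultimately show ?thesis
    using n by (simp add: poisson_kernel_def field_simps)
qed

lemma norm_cis_minus_pos: "norm z < 1 \<Longrightarrow> norm (cis t - z) > 0"
  by (metis less_irrefl norm_cis right_minus_eq zero_less_norm_iff)

lemma continuous_on_poisson_kernel_cis:
  assumes "norm z < 1"
  shows "continuous_on S (\<lambda>t. poisson_kernel z (cis t))"
  using norm_cis_minus_pos[OF assms] unfolding poisson_kernel_def
  by (intro continuous_intros) (auto simp: less_le)

lemma integral_poisson_kernel:
  assumes z: "norm z < 1"
  shows "integral {0..2*pi} (\<lambda>t. poisson_kernel z (cis t)) = 2 * pi"
proof -
  have ne: "cis t \<noteq> z" for t using norm_cis_minus_pos[OF z, of t] by auto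
  have "((\<lambda>u. 1 / (u - z)) has_contour_integral 2 * of_real pi * \<i> * 1) (circlepath 0 1)"
    by (rule Cauchy_integral_circlepath) (use z in auto)
  then have "((\<lambda>t. 1 / (cis t - z) * \<i> * cis t) has_integral 2 * of_real pi * \<i>) {0..2*pi}"
    unfolding circlepath_def by (subst (asm) has_contour_integral_part_circlepath_iff) auto
  then have "((\<lambda>t. - \<i> * (1 / (cis t - z) * \<i> * cis t)) has_integral - \<i> * (2 * of_real pi * \<i>)) {0..2*pi}"
    by (rule has_integral_mult_right)
  then have "((\<lambda>t. cis t / (cis t - z)) has_integral 2 * of_real pi) {0..2*pi}"
    by (simp add: field_simps)
  from has_integral_linear[OF this bounded_linear_Re]
  have "((\<lambda>t. Re (cis t / (cis t - z))) has_integral 2 * pi) {0..2*pi}"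
    by (simp add: o_def)
  from has_integral_mult_right[OF this, of 2]
  have "((\<lambda>t. 2 * Re (cis t / (cis t - z))) has_integral 2 * (2 * pi)) {0..2*pi}" .
  from has_integral_diff[OF this has_integral_const_real[of 1 0 "2*pi"]]
  have "((\<lambda>t. 2 * Re (cis t / (cis t - z)) - 1) has_integral 2 * pi) {0..2*pi}"
    by simp
  then show ?thesis using ne by (simp add: poisson_kernel_eq_Re integral_unique)
qed

text \<open>Rotating the point is the same as rotating the boundary values.  The kernel then no longer
depends on the rotation, as Minkowski's inequality requires.\<close>

lemma poisson_integral_rotate:
  assumes \<phi>: "continuous_on (sphere 0 1) \<phi>" and z: "norm z < 1"
  shows "poisson_integral \<phi> (cis \<eta> * z) = of_real (1 / (2 * pi)) *
    integral {0..2*pi} (\<lambda>t. of_real (poisson_kernel z (cis t)) * \<phi> (cis \<eta> * cis t))"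
proof -
  have z': "norm (cis \<eta> * z) < 1" using z by (simp add: norm_mult)
  define f where "f t = \<phi> (cis t) * of_real (poisson_kernel (cis \<eta> * z) (cis t))" for t
  have f: "continuous_on S f" for S
    unfolding f_def
    by (intro continuous_intros continuous_on_compose2[OF \<phi>] continuous_on_poisson_kernel_cis[OF z']) auto
  have "integrable (lebesgue_on {0..2*pi}) f"
    by (intro continuous_imp_integrable_real f)
  then have "integral\<^sup>L (lebesgue_on {0..2*pi}) f = integral {0..2*pi} f"
    by (rule lebesgue_integral_eq_integral) auto
  also have "\<dots> = integral {0..2*pi} (\<lambda>t. f (t + \<eta>))"
    by (intro integral_periodic_shift[symmetric] f) (auto simp: f_def simp flip: cis_mult)
  also have "(\<lambda>t. f (t + \<eta>)) = (\<lambda>t. of_real (poisson_kernel z (cis t)) * \<phi> (cis \<eta> * cis t))"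
  proof
    fix t
    have "norm (cis (t + \<eta>) - cis \<eta> * z) = norm (cis \<eta> * (cis t - z))"
      by (simp add: algebra_simps cis_mult)
    then have "norm (cis (t + \<eta>) - cis \<eta> * z) = norm (cis t - z)" by (simp add: norm_mult)
    then show "f (t + \<eta>) = of_real (poisson_kernel z (cis t)) * \<phi> (cis \<eta> * cis t)"
      by (simp add: f_def poisson_kernel_def norm_mult cis_mult add.commute mult.commute)
  qed
  finally show ?thesis
    by (simp add: poisson_integral_def f_def poisson_kernel_def)
qed

text \<open>The distance from an inner point \<open>z\<close> to the circle is controlled by its depth \<open>1 - norm z\<close> and by
the distance to the boundary point \<open>\<zeta>\<close> nearest to \<open>z\<close>.  All kernel bounds below are stated in these
terms, so that the remaining integrals only involve the distance to \<open>\<zeta>\<close>.\<close>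

lemma max_le_norm_diff_inside:
  assumes "norm u = 1" "norm \<zeta> = 1" "norm (\<zeta> - z) = 1 - norm z"
  shows "max (1 - norm z) (norm (u - \<zeta>) / 2) \<le> norm (u - z)"
proof -
  have "1 - norm z \<le> norm (u - z)"
    using norm_triangle_ineq2[of u z] assms by simp
  moreover have "norm (u - \<zeta>) \<le> norm (u - z) + norm (\<zeta> - z)"
    using norm_triangle_ineq4[of "u - z" "\<zeta> - z"] by simp
  ultimately show ?thesis using assms by simp
qed

lemma poisson_kernel_le:
  assumes "norm z < 1"
  shows "poisson_kernel z u \<le> 2 * (1 - norm z) / (norm (u - z))\<^sup>2"
proof -
  have "1 - (norm z)\<^sup>2 = (1 - norm z) * (1 + norm z)" by (simp add: power2_eq_square algebra_simps)
  also have "\<dots> \<le> (1 - norm z) * 2" using assms by (intro mult_left_mono) auto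
  finally show ?thesis unfolding poisson_kernel_def by (intro divide_right_mono) auto
qed

text \<open>If the distance of \<open>z'\<close> from \<open>z\<close> is at most half the depth of \<open>z\<close>, then \<open>norm (u - z')\<close> is at least half of
\<open>norm (u - z)\<close>, and the resolvent identity for \<open>u / (u - z)\<close> gives the bound without any
differentiation.\<close>

lemma poisson_kernel_diff_le:
  assumes u: "norm u = 1" and z: "norm z < 1" and d: "2 * norm (z - z') \<le> 1 - norm z"
  shows "\<bar>poisson_kernel z u - poisson_kernel z' u\<bar> \<le> 4 * norm (z - z') / (norm (u - z))\<^sup>2"
proof -
  define a where "a = norm (u - z)"
  define b where "b = norm (u - z')"
  have a: "a \<ge> 1 - norm z" using norm_triangle_ineq2[of u z] u by (simp add: a_def)
  have "a \<le> b + norm (z - z')"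
    unfolding a_def b_def using norm_triangle_ineq4[of "u - z'" "z - z'"] by simp
  with a d have b: "b \<ge> a / 2" by simp
  have a0: "a > 0" using a z by simp
  then have ne: "u \<noteq> z" "u \<noteq> z'" using b by (auto simp: a_def b_def)
  have eq: "u / (u - z) - u / (u - z') = u * (z - z') / ((u - z) * (u - z'))"
    using ne by (simp add: field_simps)
  have "\<bar>poisson_kernel z u - poisson_kernel z' u\<bar> = 2 * \<bar>Re (u / (u - z) - u / (u - z'))\<bar>"
    using ne u by (simp add: poisson_kernel_eq_Re abs_if)
  also have "\<dots> \<le> 2 * norm (u / (u - z) - u / (u - z'))"
    by (intro mult_left_mono abs_Re_le_cmod) auto
  also have "\<dots> = 2 * norm (z - z') / (a * b)"
    unfolding eq by (simp add: norm_mult norm_divide u a_def b_def)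
  also have "\<dots> \<le> 2 * norm (z - z') / (a * (a / 2))"
    using a0 b by (intro divide_left_mono mult_left_mono) auto
  also have "\<dots> = 4 * norm (z - z') / a\<^sup>2"
    using a0 by (simp add: power2_eq_square field_simps)
  finally show ?thesis unfolding a_def .
qed

section \<open>Integrals of slow majorants\<close>

lemma majorantD:
  assumes "majorant \<omega>"
  shows "continuous_on {0..} \<omega>" "\<And>s t. 0 \<le> s \<Longrightarrow> s \<le> t \<Longrightarrow> \<omega> s \<le> \<omega> t"
    "\<And>t. t \<ge> 0 \<Longrightarrow> \<omega> t \<ge> 0" "\<omega> 0 = 0"
    "\<And>s t. 0 < s \<Longrightarrow> s \<le> t \<Longrightarrow> \<omega> t / t \<le> \<omega> s / s"
  using assms by (auto simp: majorant_def monotone_on_def)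

lemma majorant_scale:
  assumes \<omega>: "majorant \<omega>" and "0 \<le> s" "c \<ge> 1" "s \<le> c * t" "t \<ge> 0"
  shows "\<omega> s \<le> c * \<omega> t"
proof (cases "t = 0")
  case False
  with assms have t: "t > 0" by simp
  have ct: "t \<le> c * t" using assms(3) t by simp
  have "\<omega> (c * t) / (c * t) \<le> \<omega> t / t" using t ct by (intro majorantD(5)[OF \<omega>])
  then have "\<omega> (c * t) \<le> c * \<omega> t" using t assms(3) by (simp add: field_simps)
  moreover have "\<omega> s \<le> \<omega> (c * t)" using assms by (intro majorantD(2)[OF \<omega>]) auto
  ultimately show ?thesis by simp
qed (use assms majorantD(4)[OF \<omega>] in simp)

text \<open>The slowness condition is only imposed for small \<open>d\<close>.  It extends to any bounded range by
comparison with a fixed small \<open>d0\<close>: the tail integral decreases and \<open>\<omega>\<close> increases with \<open>d\<close>.\<close>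

lemma slow_majorant_bounded_range:
  assumes \<omega>: "slow_majorant \<omega>" and R: "R > 0"
  obtains C where "C > 0" "\<And>d. 0 < d \<Longrightarrow> d \<le> R \<Longrightarrow>
    ennreal d * (\<integral>\<^sup>+t\<in>{d..}. ennreal (\<omega> t / t\<^sup>2) \<partial>lborel) \<le> ennreal (C * \<omega> d)"
proof -
  from \<omega> obtain \<delta> M where m: "majorant \<omega>" and \<delta>: "\<delta> > 0" and M: "M > 0" and
    slow: "\<And>d. 0 < d \<Longrightarrow> d < \<delta> \<Longrightarrow>
      ennreal d * (\<integral>\<^sup>+t\<in>{d..}. ennreal (\<omega> t / t\<^sup>2) \<partial>lborel) \<le> ennreal (M * \<omega> d)"
    unfolding slow_majorant_def by auto
  define d0 where "d0 = \<delta> / 2"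
  have d0: "d0 > 0" "d0 < \<delta>" using \<delta> by (auto simp: d0_def)
  define C where "C = max 1 (R / d0) * M"
  show ?thesis
  proof (rule that[of C])
    show "C > 0" using M by (simp add: C_def)
    fix d assume d: "0 < d" "d \<le> R"
    let ?I = "\<lambda>d. \<integral>\<^sup>+t\<in>{d..}. ennreal (\<omega> t / t\<^sup>2) \<partial>lborel"
    have wd: "\<omega> d \<ge> 0" using d by (intro majorantD[OF m]) auto
    show "ennreal d * ?I d \<le> ennreal (C * \<omega> d)"
    proof (cases "d < \<delta>")
      case True
      have "ennreal d * ?I d \<le> ennreal (M * \<omega> d)" using d True by (intro slow)
      also have "\<dots> \<le> ennreal (C * \<omega> d)"
        using M wd by (intro ennreal_leI mult_right_mono) (auto simp: C_def)
      finally show ?thesis .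
    next
      case False
      have "ennreal d * ?I d \<le> ennreal (R / d0 * d0) * ?I d0"
        using d d0 False
        by (intro mult_mono nn_integral_mono ennreal_leI) (auto simp: indicator_def)
      also have "\<dots> = ennreal (R / d0) * (ennreal d0 * ?I d0)"
        using d0 R by (simp add: ennreal_mult mult.assoc del: times_divide_eq_left)
      also have "\<dots> \<le> ennreal (R / d0) * ennreal (M * \<omega> d0)"
        using d0 by (intro mult_left_mono slow) auto
      also have "\<dots> = ennreal (R / d0 * M * \<omega> d0)"
        using d0 R M by (simp flip: ennreal_mult add: majorantD[OF m])
      also have "\<dots> \<le> ennreal (C * \<omega> d)"
      proof (intro ennreal_leI mult_mono)
        show "R / d0 * M \<le> C" unfolding C_def using M by (intro mult_right_mono) auto
        then show "0 \<le> C" using R d0 M by (intro order_trans[OF _ \<open>R / d0 * M \<le> C\<close>]) auto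
      qed (use d0 False in \<open>auto simp: d0_def intro!: majorantD[OF m]\<close>)
      finally show ?thesis .
    qed
  qed
qed

lemma integral_majorant_tail_le:
  assumes \<omega>: "majorant \<omega>" and d: "d > 0" and C: "C \<ge> 0"
    and slow: "ennreal d * (\<integral>\<^sup>+t\<in>{d..}. ennreal (\<omega> t / t\<^sup>2) \<partial>lborel) \<le> ennreal (C * \<omega> d)"
  shows "integral {d..b} (\<lambda>t. \<omega> t / t\<^sup>2) \<le> C * \<omega> d / d"
proof -
  let ?I = "integral {d..b} (\<lambda>t. \<omega> t / t\<^sup>2)"
  have cont: "continuous_on {d..b} (\<lambda>t. \<omega> t / t\<^sup>2)"
    using d by (intro continuous_intros continuous_on_subset[OF majorantD(1)[OF \<omega>]]) auto
  have "ennreal ?I = (\<integral>\<^sup>+t. ennreal (\<omega> t / t\<^sup>2) * indicator {d..b} t \<partial>lborel)"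
    using d by (intro nn_integral_has_integral_lebesgue'[symmetric] integrable_integral
        integrable_continuous_interval cont) (auto intro!: divide_nonneg_nonneg majorantD[OF \<omega>])
  also have "\<dots> \<le> (\<integral>\<^sup>+t\<in>{d..}. ennreal (\<omega> t / t\<^sup>2) \<partial>lborel)"
    by (intro nn_integral_mono) (auto simp: indicator_def)
  finally have "ennreal d * ennreal ?I \<le> ennreal d * (\<integral>\<^sup>+t\<in>{d..}. ennreal (\<omega> t / t\<^sup>2) \<partial>lborel)"
    by (intro mult_left_mono) auto
  also note slow
  finally have "ennreal (d * ?I) \<le> ennreal (C * \<omega> d)" using d by (simp add: ennreal_mult')
  then have "d * ?I \<le> C * \<omega> d" using d C by (simp add: majorantD[OF \<omega>])
  then show ?thesis using d by (simp add: field_simps)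
qed

text \<open>On \<open>{0..d}\<close> the integrand is at most \<open>\<omega> d / d\<^sup>2\<close>, and beyond \<open>d\<close> slowness applies.\<close>

lemma integral_majorant_truncated_le:
  assumes \<omega>: "majorant \<omega>" and d: "0 < d" "d \<le> b" and c: "c > 0" and C: "C \<ge> 0"
    and slow: "ennreal d * (\<integral>\<^sup>+t\<in>{d..}. ennreal (\<omega> t / t\<^sup>2) \<partial>lborel) \<le> ennreal (C * \<omega> d)"
  shows "integral {0..b} (\<lambda>t. \<omega> t / (max d (t / c))\<^sup>2) \<le> (1 + c\<^sup>2 * C) * \<omega> d / d"
proof -
  let ?h = "\<lambda>t. \<omega> t / (max d (t / c))\<^sup>2"
  have cont: "continuous_on {0..b} ?h"
    using d c by (intro continuous_intros continuous_on_subset[OF majorantD(1)[OF \<omega>]]) auto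
  have int: "?h integrable_on {s..t}" if "0 \<le> s" "t \<le> b" for s t
    using that by (intro integrable_continuous_interval continuous_on_subset[OF cont]) auto
  have "integral {0..d} ?h \<le> integral {0..d} (\<lambda>t. \<omega> d / d\<^sup>2)"
    using d by (intro integral_le int) (auto intro!: frac_le power_mono majorantD[OF \<omega>])
  also have "\<dots> = \<omega> d / d" using d by (simp add: power2_eq_square)
  finally have 1: "integral {0..d} ?h \<le> \<omega> d / d" .
  have "integral {d..b} ?h \<le> integral {d..b} (\<lambda>t. c\<^sup>2 * (\<omega> t / t\<^sup>2))"
  proof (rule integral_le)
    show "(\<lambda>t. c\<^sup>2 * (\<omega> t / t\<^sup>2)) integrable_on {d..b}"
      using d by (intro integrable_continuous_interval continuous_intros continuous_on_subset[OF majorantD(1)[OF \<omega>]]) auto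
    fix t assume t: "t \<in> {d..b}"
    then have "?h t \<le> \<omega> t / (t / c)\<^sup>2"
      using d c by (intro frac_le power_mono majorantD[OF \<omega>]) auto
    then show "?h t \<le> c\<^sup>2 * (\<omega> t / t\<^sup>2)" by (simp add: power_divide mult.commute)
  qed (use d int in auto)
  also have "\<dots> = c\<^sup>2 * integral {d..b} (\<lambda>t. \<omega> t / t\<^sup>2)"
    by (rule integral_mult_right)
  also have "\<dots> \<le> c\<^sup>2 * (C * \<omega> d / d)"
    using integral_majorant_tail_le[OF \<omega> d(1) C slow] by (intro mult_left_mono) auto
  finally have 2: "integral {d..b} ?h \<le> c\<^sup>2 * (C * \<omega> d / d)" .
  have "integral {0..b} ?h = integral {0..d} ?h + integral {d..b} ?h"
    using d int by (intro Henstock_Kurzweil_Integration.integral_combine[symmetric]) auto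
  moreover have "(1 + c\<^sup>2 * C) * \<omega> d / d = \<omega> d / d + c\<^sup>2 * (C * \<omega> d / d)"
    by (simp add: algebra_simps add_divide_distrib)
  ultimately show ?thesis using 1 2 by simp
qed

text \<open>The sine is concave on \<open>{0..pi}\<close>, so it lies above its chord from \<open>0\<close> to \<open>pi / 2\<close>.\<close>

lemma sin_ge_Jordan:
  assumes "0 \<le> x" "x \<le> pi / 2"
  shows "2 * x / pi \<le> sin x"
proof -
  have "convex_on {0..pi} (\<lambda>x. - sin x)"
    by (rule f''_ge0_imp_convex[where f' = "\<lambda>x. - cos x" and f'' = sin])
       (auto intro!: derivative_eq_intros sin_ge_zero)
  from convex_onD[OF this, of "2 * x / pi" 0 "pi / 2"] show ?thesis
    using assms by (simp add: field_simps)
qed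

lemma norm_cis_minus_1: "norm (cis t - 1) = 2 * \<bar>sin (t / 2)\<bar>"
proof (rule power2_eq_imp_eq)
  have c: "cos t = 1 - 2 * (sin (t / 2))\<^sup>2" using cos_double_sin[of "t / 2"] by simp
  have "(norm (cis t - 1))\<^sup>2 = (cos t)\<^sup>2 + (sin t)\<^sup>2 + 1 - 2 * cos t"
    unfolding cmod_power2 by (simp add: power2_eq_square algebra_simps)
  also have "\<dots> = 2 - 2 * cos t" by simp
  also have "\<dots> = 4 * (sin (t / 2))\<^sup>2" by (subst c) simp
  finally show "(norm (cis t - 1))\<^sup>2 = (2 * \<bar>sin (t / 2)\<bar>)\<^sup>2" by (simp add: power_mult_distrib)
qed auto

lemma norm_cis_minus_1_bounds:
  assumes "0 \<le> t" "t \<le> pi"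
  shows "norm (cis t - 1) \<le> t" "t / pi \<le> norm (cis t - 1) / 2"
proof -
  have s: "sin (t / 2) \<ge> 0" using assms by (intro sin_ge_zero) auto
  show "norm (cis t - 1) \<le> t"
    using s assms sin_x_le_x[of "t / 2"] by (simp add: norm_cis_minus_1)
  show "t / pi \<le> norm (cis t - 1) / 2"
    using s assms sin_ge_Jordan[of "t / 2"] by (simp add: norm_cis_minus_1)
qed

text \<open>The distance of \<open>cis t\<close> from a point of the circle is comparable to the length of the shorter of
the two arcs between them.  Bounding the integrand on both half circles turns the integral over
the circle into two copies of the integral over an interval.\<close>

lemma integral_majorant_circle_le:
  assumes \<omega>: "majorant \<omega>" and d: "0 < d" "d \<le> 2" and C: "C \<ge> 0" and \<zeta>: "norm \<zeta> = 1"
    and slow: "ennreal d * (\<integral>\<^sup>+t\<in>{d..}. ennreal (\<omega> t / t\<^sup>2) \<partial>lborel) \<le> ennreal (C * \<omega> d)"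
  shows "integral {0..2*pi} (\<lambda>t. \<omega> (norm (cis t - \<zeta>)) / (max d (norm (cis t - \<zeta>) / 2))\<^sup>2)
    \<le> 2 * (1 + pi\<^sup>2 * C) * \<omega> d / d"
proof -
  define f where "f t = \<omega> (norm (cis t - 1)) / (max d (norm (cis t - 1) / 2))\<^sup>2" for t
  define h where "h t = \<omega> t / (max d (t / pi))\<^sup>2" for t
  have f: "continuous_on S f" for S
    unfolding f_def using d
    by (intro continuous_intros continuous_on_compose2[OF majorantD(1)[OF \<omega>]]) auto
  have h: "continuous_on {0..2*pi} h"
    unfolding h_def using d by (intro continuous_intros continuous_on_subset[OF majorantD(1)[OF \<omega>]]) auto
  have h0: "h t \<ge> 0" if "t \<ge> 0" for t
    using that by (auto simp: h_def intro!: divide_nonneg_nonneg majorantD[OF \<omega>])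
  have fh: "f t \<le> h t" if "0 \<le> t" "t \<le> pi" for t
  proof -
    have "(max d (t / pi))\<^sup>2 \<le> (max d (norm (cis t - 1) / 2))\<^sup>2"
      using norm_cis_minus_1_bounds[OF that] d by (intro power_mono max.mono) auto
    moreover have "\<omega> (norm (cis t - 1)) \<le> \<omega> t"
      using norm_cis_minus_1_bounds[OF that] by (intro majorantD(2)[OF \<omega>]) auto
    ultimately show ?thesis
      unfolding f_def h_def using that d by (intro frac_le majorantD(3)[OF \<omega>]) auto
  qed
  have f_reflect: "f (2 * pi - t) = f t" for t
  proof -
    have "cis (2 * pi - t) - 1 = cnj (cis t - 1)" by (simp add: complex_eq_iff)
    then show ?thesis by (simp only: f_def complex_mod_cnj)
  qed
  obtain \<alpha> where \<alpha>: "\<zeta> = cis \<alpha>" using \<zeta> by (metis rcis_cmod_Arg rcis_def mult_1 of_real_1)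
  have "norm (cis t - \<zeta>) = norm (cis (t + - \<alpha>) - 1)" for t
  proof -
    have "cis t - \<zeta> = \<zeta> * (cis (t + - \<alpha>) - 1)" by (simp add: \<alpha> algebra_simps cis_mult)
    then show ?thesis using \<zeta> by (simp add: norm_mult)
  qed
  then have "integral {0..2*pi} (\<lambda>t. \<omega> (norm (cis t - \<zeta>)) / (max d (norm (cis t - \<zeta>) / 2))\<^sup>2)
      = integral {0..2*pi} (\<lambda>t. f (t + - \<alpha>))" by (simp add: f_def)
  also have "\<dots> = integral {0..2*pi} f"
    by (rule integral_periodic_shift) (auto simp: f, simp add: f_def flip: cis_mult)
  also have "\<dots> \<le> integral {0..2*pi} (\<lambda>t. h t + h (2 * pi - t))"
  proof (rule integral_le)
    show "(\<lambda>t. h t + h (2 * pi - t)) integrable_on {0..2*pi}"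
      by (intro integrable_continuous_interval continuous_intros h continuous_on_compose2[OF h]) auto
    fix t assume t: "t \<in> {0..2*pi}"
    show "f t \<le> h t + h (2 * pi - t)"
    proof (cases "t \<le> pi")
      case True
      then show ?thesis using fh[of t] h0[of "2 * pi - t"] t by auto
    next
      case False
      then show ?thesis using fh[of "2 * pi - t"] h0[of t] t by (auto simp: f_reflect)
    qed
  qed (intro integrable_continuous_interval f)
  also have "\<dots> = integral {0..2*pi} h + integral {0..2*pi} (\<lambda>t. h (2 * pi - t))"
    by (intro integral_add integrable_continuous_interval h continuous_on_compose2[OF h] continuous_intros) auto
  also have "integral {0..2*pi} (\<lambda>t. h (2 * pi - t)) = integral {0..2*pi} h"
  proof -
    have "integral {0..2*pi} (\<lambda>t. h (2 * pi - t)) = integral {- (2 * pi)..-0} (\<lambda>t. h (2 * pi + t))"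
      using Henstock_Kurzweil_Integration.integral_reflect_real[of "2*pi" 0 "\<lambda>t. h (2 * pi - t)"] by simp
    also have "\<dots> = integral {0..2*pi} h"
      using integral_shift_real_ivl[of 0 "2*pi" "2*pi" h] by (simp add: add.commute)
    finally show ?thesis .
  qed
  also have "integral {0..2*pi} h + integral {0..2*pi} h \<le> 2 * ((1 + pi\<^sup>2 * C) * \<omega> d / d)"
    unfolding h_def
    using integral_majorant_truncated_le[OF \<omega> d(1) _ pi_gt_zero C slow, of "2*pi"] d pi_gt3 by simp
  finally show ?thesis by (simp only: times_divide_eq_right mult.assoc)
qed

section \<open>Differences of Poisson integrals\<close>

text \<open>Since the kernel has mass one, a constant can be subtracted under the integral.\<close>

lemma poisson_integral_diff_const:
  assumes \<phi>: "continuous_on (sphere 0 1) \<phi>" and z: "norm z < 1"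
  shows "poisson_integral \<phi> (cis \<eta> * z) - c =
    integral {0..2*pi} (\<lambda>t. of_real (poisson_kernel z (cis t) / (2 * pi)) * (\<phi> (cis \<eta> * cis t) - c))"
proof -
  let ?K = "\<lambda>t. complex_of_real (poisson_kernel z (cis t))"
  let ?f = "\<lambda>t. \<phi> (cis \<eta> * cis t)"
  have K: "continuous_on {0..2*pi} ?K"
    by (intro continuous_intros continuous_on_poisson_kernel_cis z)
  have f: "continuous_on {0..2*pi} ?f"
    by (intro continuous_on_compose2[OF \<phi>] continuous_intros) (auto simp: norm_mult)
  have "integral {0..2*pi} ?K = 2 * pi"
    using integral_linear[OF integrable_continuous_interval[OF continuous_on_poisson_kernel_cis[OF z]]
        bounded_linear_of_real[where 'a = complex], of 0 "2 * pi"]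
    by (simp add: o_def integral_poisson_kernel z)
  then have "integral {0..2*pi} (\<lambda>t. ?K t * c) = 2 * pi * c"
    by (simp add: integral_mult_left)
  moreover have "integral {0..2*pi} (\<lambda>t. ?K t * (?f t - c))
      = integral {0..2*pi} (\<lambda>t. ?K t * ?f t) - integral {0..2*pi} (\<lambda>t. ?K t * c)"
    unfolding right_diff_distrib
    by (intro integral_diff integrable_continuous_interval continuous_intros K f)
  moreover have "integral {0..2*pi} (\<lambda>t. of_real (poisson_kernel z (cis t) / (2 * pi)) * (?f t - c))
      = of_real (1 / (2 * pi)) * integral {0..2*pi} (\<lambda>t. ?K t * (?f t - c))"
    by (subst integral_mult_right[symmetric]) (auto intro!: integral_cong)
  ultimately have "integral {0..2*pi} (\<lambda>t. of_real (poisson_kernel z (cis t) / (2 * pi)) * (?f t - c))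
      = of_real (1 / (2 * pi)) * (integral {0..2*pi} (\<lambda>t. ?K t * ?f t) - 2 * pi * c)"
    by (simp only:)
  also have "\<dots> = poisson_integral \<phi> (cis \<eta> * z) - c"
    unfolding poisson_integral_rotate[OF \<phi> z] right_diff_distrib by simp
  finally show ?thesis by (rule sym)
qed

lemma norm_integral_mult_le:
  fixes k :: "real \<Rightarrow> real" and f :: "real \<Rightarrow> complex"
  assumes "continuous_on {a..b} k" "continuous_on {a..b} f"
  shows "norm (integral {a..b} (\<lambda>t. of_real (k t) * f t)) \<le> integral {a..b} (\<lambda>t. \<bar>k t\<bar> * norm (f t))"
  using assms
  by (intro integral_norm_bound_integral integrable_continuous_interval continuous_intros)
     (auto simp: norm_mult)

text \<open>Here the subtracted constant is the boundary value at \<open>\<zeta>\<close>.\<close>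

lemma poisson_boundary_diff_le:
  assumes \<phi>: "continuous_on (sphere 0 1) \<phi>" and z: "norm z < 1" and \<zeta>: "norm \<zeta> = 1"
  shows "norm (poisson_extension \<phi> (cis \<eta> * z) - poisson_extension \<phi> (cis \<eta> * \<zeta>))
    \<le> integral {0..2*pi} (\<lambda>t. poisson_kernel z (cis t) / (2 * pi) *
          norm (\<phi> (cis \<eta> * cis t) - \<phi> (cis \<eta> * \<zeta>)))"
proof -
  have "poisson_extension \<phi> (cis \<eta> * z) - poisson_extension \<phi> (cis \<eta> * \<zeta>)
     = poisson_integral \<phi> (cis \<eta> * z) - \<phi> (cis \<eta> * \<zeta>)"
    using z \<zeta> by (simp add: poisson_extension_def norm_mult)
  also have "norm \<dots> \<le> integral {0..2*pi} (\<lambda>t. \<bar>poisson_kernel z (cis t) / (2 * pi)\<bar> *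
          norm (\<phi> (cis \<eta> * cis t) - \<phi> (cis \<eta> * \<zeta>)))"
    unfolding poisson_integral_diff_const[OF \<phi> z]
    by (intro norm_integral_mult_le continuous_intros continuous_on_poisson_kernel_cis z
        continuous_on_compose2[OF \<phi>]) (auto simp: norm_mult)
  finally show ?thesis using z by (simp add: poisson_kernel_nonneg)
qed

text \<open>The difference of two kernels has integral zero, so the boundary value at an arbitrary point \<open>\<zeta>\<close>
can be subtracted; the choice of \<open>\<zeta>\<close> near the two points makes the integrand small where the
kernels are large.\<close>

lemma poisson_interior_diff_le:
  assumes \<phi>: "continuous_on (sphere 0 1) \<phi>" and z: "norm z < 1" and z': "norm z' < 1"
  shows "norm (poisson_extension \<phi> (cis \<eta> * z) - poisson_extension \<phi> (cis \<eta> * z'))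
    \<le> integral {0..2*pi} (\<lambda>t. \<bar>poisson_kernel z (cis t) - poisson_kernel z' (cis t)\<bar> / (2 * pi) *
          norm (\<phi> (cis \<eta> * cis t) - \<phi> (cis \<eta> * \<zeta>)))"
proof -
  let ?c = "\<phi> (cis \<eta> * \<zeta>)"
  let ?f = "\<lambda>t. \<phi> (cis \<eta> * cis t) - ?c"
  have f: "continuous_on {0..2*pi} ?f"
    by (intro continuous_on_compose2[OF \<phi>] continuous_intros) (auto simp: norm_mult)
  note K = continuous_on_poisson_kernel_cis[OF z] continuous_on_poisson_kernel_cis[OF z']
  have "poisson_extension \<phi> (cis \<eta> * z) - poisson_extension \<phi> (cis \<eta> * z')
     = (poisson_integral \<phi> (cis \<eta> * z) - ?c) - (poisson_integral \<phi> (cis \<eta> * z') - ?c)"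
    using z z' by (simp add: poisson_extension_def norm_mult)
  also have "\<dots> = integral {0..2*pi} (\<lambda>t. of_real (poisson_kernel z (cis t) / (2 * pi)) * ?f t
       - of_real (poisson_kernel z' (cis t) / (2 * pi)) * ?f t)"
    unfolding poisson_integral_diff_const[OF \<phi> z] poisson_integral_diff_const[OF \<phi> z']
    by (intro integral_diff[symmetric] integrable_continuous_interval continuous_intros f K) auto
  also have "\<dots> = integral {0..2*pi}
      (\<lambda>t. of_real ((poisson_kernel z (cis t) - poisson_kernel z' (cis t)) / (2 * pi)) * ?f t)"
    by (simp add: diff_divide_distrib algebra_simps)
  also have "norm \<dots> \<le> integral {0..2*pi}
      (\<lambda>t. \<bar>(poisson_kernel z (cis t) - poisson_kernel z' (cis t)) / (2 * pi)\<bar> * norm (?f t))"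
    by (intro norm_integral_mult_le continuous_intros f K) auto
  finally show ?thesis by simp
qed

text \<open>The extension is continuous on the open disk and on the circle separately, which already makes it
a Borel function.\<close>

lemma borel_measurable_poisson_extension:
  assumes \<phi>: "continuous_on (sphere 0 1) \<phi>"
  shows "poisson_extension \<phi> \<in> borel_measurable (restrict_space borel (cball 0 1))"
proof -
  have ne: "norm z < 1 \<Longrightarrow> cis t \<noteq> z" for z t
    using norm_cis_minus_pos[of z t] by auto
  have "continuous_on (ball 0 1) (\<lambda>z. integral (cbox 0 (2*pi))
      (\<lambda>t. of_real (poisson_kernel z (cis t)) * \<phi> (cis t)))"
    unfolding poisson_kernel_def using ne
    by (intro integral_continuous_on_param)
       (auto simp: split_beta' intro!: continuous_intros continuous_on_compose2[OF \<phi>])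
  then have ball: "continuous_on (ball 0 1) (poisson_integral \<phi>)"
    using poisson_integral_rotate[OF \<phi>, where \<eta> = 0]
    by (subst continuous_on_cong[OF refl, where g = "\<lambda>z. of_real (1 / (2 * pi)) *
          integral {0..2*pi} (\<lambda>t. of_real (poisson_kernel z (cis t)) * \<phi> (cis t))"])
       (auto intro!: continuous_intros)
  \<comment> \<open>Extended by zero outside the closed disk, the function is continuous on the circle and on
    its complement.\<close>
  define G where "G z = (if z \<in> sphere 0 1 then \<phi> z else if z \<in> ball 0 1 then poisson_integral \<phi> z else 0)" for z
  have "continuous_on (- sphere 0 1) (\<lambda>z. if z \<in> ball 0 1 then poisson_integral \<phi> z else 0)"
  proof -
    have eq: "- sphere (0::complex) 1 = ball 0 1 \<union> - cball 0 1" by auto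
    show ?thesis
      unfolding eq
    proof (rule continuous_on_open_Un)
      show "continuous_on (ball 0 1) (\<lambda>z. if z \<in> ball 0 1 then poisson_integral \<phi> z else 0)"
        using ball by (subst continuous_on_cong[OF refl, where g = "poisson_integral \<phi>"]) auto
      show "continuous_on (- cball 0 1) (\<lambda>z. if z \<in> ball 0 1 then poisson_integral \<phi> z else 0)"
        by (subst continuous_on_cong[OF refl, where g = "\<lambda>_. 0"]) auto
    qed auto
  qed
  then have "G \<in> borel_measurable borel"
    unfolding G_def by (intro borel_measurable_continuous_on_if \<phi>) auto
  then have "G \<in> borel_measurable (restrict_space borel (cball 0 1))"
    by (rule measurable_restrict_space1)
  also have "?this \<longleftrightarrow> ?thesis"
    by (intro measurable_cong) (auto simp: G_def poisson_extension_def space_restrict_space)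
  finally show ?thesis .
qed

text \<open>The estimate common to radial and to small interior displacements.  The distance \<open>d\<close> over which
the function is compared and the depth \<open>\<delta>\<close> at which the kernel is cut off may differ; since the
cut-off kernel decreases in \<open>\<delta>\<close>, it can be replaced by the one cut off at \<open>d\<close>, and slowness is
used at the scale \<open>d\<close>.  The radial case is \<open>d = \<delta>\<close>.\<close>

lemma Lp_diff_poisson_le_kernel:
  fixes k :: "real \<Rightarrow> real"
  assumes \<omega>: "majorant \<omega>" and p: "1 \<le> p" and \<phi>: "continuous_on (sphere 0 1) \<phi>"
    and M: "M \<ge> 0" "\<And>\<xi>\<^sub>1 \<xi>\<^sub>2. norm \<xi>\<^sub>1 = 1 \<Longrightarrow> norm \<xi>\<^sub>2 = 1 \<Longrightarrow>
      Lp_diff p \<phi> \<xi>\<^sub>1 \<xi>\<^sub>2 \<le> ennreal (M * \<omega> (norm (\<xi>\<^sub>1 - \<xi>\<^sub>2)))"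
    and \<zeta>: "norm \<zeta> = 1" and d: "0 < d" "d \<le> \<delta>" "d \<le> 2" and C: "C \<ge> 0"
    and slow: "ennreal d * (\<integral>\<^sup>+t\<in>{d..}. ennreal (\<omega> t / t\<^sup>2) \<partial>lborel) \<le> ennreal (C * \<omega> d)"
    and k: "continuous_on UNIV k" "\<And>t. k t \<ge> 0"
      "\<And>t. k t \<le> 4 * d / (max \<delta> (norm (cis t - \<zeta>) / 2))\<^sup>2"
    and F: "\<And>\<eta>. norm (F (cis \<eta> * x) - F (cis \<eta> * y))
      \<le> integral {0..2*pi} (\<lambda>t. k t / (2 * pi) * norm (\<phi> (cis \<eta> * cis t) - \<phi> (cis \<eta> * \<zeta>)))"
  shows "Lp_diff p F x y \<le> ennreal (4 * M * (1 + pi\<^sup>2 * C) * \<omega> d)"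
proof (rule Lp_diff_mono)
  define s where "s t = norm (cis t - \<zeta>)" for t
  have s: "continuous_on S s" "s t \<ge> 0" for S t
    unfolding s_def by (auto intro!: continuous_intros)
  have \<omega>s: "continuous_on S (\<lambda>t. \<omega> (s t))" for S
    by (intro continuous_on_compose2[OF majorantD(1)[OF \<omega>]] s) (auto simp: s)
  have \<omega>s0: "\<omega> (s t) \<ge> 0" for t by (intro majorantD[OF \<omega>] s)
  show "Lp_diff p F x y \<le> ennreal (integral {0..2*pi} (\<lambda>t. k t / (2 * pi) * (M * \<omega> (s t))))"
  proof (rule Lp_diff_le_integral[OF p \<phi> \<zeta>])
    show "Lp_diff p \<phi> (cis t) \<zeta> \<le> ennreal (M * \<omega> (s t))" for t
      unfolding s_def using \<zeta> by (intro M) auto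
  qed (use k M \<omega>s0 F in \<open>auto intro!: continuous_intros \<omega>s\<close>)
  have "integral {0..2*pi} (\<lambda>t. k t / (2 * pi) * (M * \<omega> (s t)))
      \<le> integral {0..2*pi} (\<lambda>t. 4 * d * M / (2 * pi) * (\<omega> (s t) / (max d (s t / 2))\<^sup>2))"
  proof (rule integral_le)
    show "(\<lambda>t. k t / (2 * pi) * (M * \<omega> (s t))) integrable_on {0..2*pi}"
      by (intro integrable_continuous_interval continuous_intros \<omega>s continuous_on_subset[OF k(1)]) auto
    show "(\<lambda>t. 4 * d * M / (2 * pi) * (\<omega> (s t) / (max d (s t / 2))\<^sup>2)) integrable_on {0..2*pi}"
      using d by (intro integrable_continuous_interval continuous_intros \<omega>s s) (auto simp: max_def)
    fix t
    have "k t \<le> 4 * d / (max d (s t / 2))\<^sup>2"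
      using d by (intro order_trans[OF k(3)] divide_left_mono power_mono mult_pos_pos)
        (auto simp: s_def intro!: max.mono)
    then have "k t * (M * \<omega> (s t) / (2 * pi)) \<le> 4 * d / (max d (s t / 2))\<^sup>2 * (M * \<omega> (s t) / (2 * pi))"
      using M \<omega>s0 by (intro mult_right_mono) auto
    then show "k t / (2 * pi) * (M * \<omega> (s t)) \<le> 4 * d * M / (2 * pi) * (\<omega> (s t) / (max d (s t / 2))\<^sup>2)"
      by (simp add: mult_ac)
  qed
  also have "\<dots> = 4 * d * M / (2 * pi) * integral {0..2*pi} (\<lambda>t. \<omega> (s t) / (max d (s t / 2))\<^sup>2)"
    by (rule integral_mult_right)
  also have "\<dots> \<le> 4 * d * M / (2 * pi) * (2 * (1 + pi\<^sup>2 * C) * \<omega> d / d)"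
    unfolding s_def using d M
    by (intro mult_left_mono integral_majorant_circle_le[OF \<omega> d(1,3) C \<zeta> slow]) auto
  also have "\<dots> = 4 * M * (1 + pi\<^sup>2 * C) * \<omega> d / pi"
    using d by (simp add: field_simps)
  also have "\<dots> \<le> 4 * M * (1 + pi\<^sup>2 * C) * \<omega> d / 1"
    using M C d pi_gt3 by (intro divide_left_mono mult_nonneg_nonneg majorantD[OF \<omega>]) auto
  finally show "integral {0..2*pi} (\<lambda>t. k t / (2 * pi) * (M * \<omega> (s t))) \<le> 4 * M * (1 + pi\<^sup>2 * C) * \<omega> d"
    by simp
qed

theorem corollary2p6:
  fixes \<omega> :: "real \<Rightarrow> real" and p :: ennreal and \<phi> :: "complex \<Rightarrow> complex"
  assumes "slow_majorant \<omega>"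
    and "1 \<le> p"
    and "\<phi> \<in> Lambda_circle \<omega> p"
    and "continuous_on (sphere 0 1) \<phi>"
  shows "poisson_extension \<phi> \<in> Lambda_disk \<omega> p"
proof -
  note p = assms(2) and \<phi> = assms(4)
  let ?F = "poisson_extension \<phi>"
  have \<omega>: "majorant \<omega>" using assms(1) by (simp add: slow_majorant_def)
  have F: "?F \<in> borel_measurable (restrict_space borel (cball 0 1))"
    by (rule borel_measurable_poisson_extension[OF \<phi>])
  obtain M where M: "M > 0" "\<And>\<xi>\<^sub>1 \<xi>\<^sub>2. norm \<xi>\<^sub>1 = 1 \<Longrightarrow> norm \<xi>\<^sub>2 = 1 \<Longrightarrow>
      Lp_diff p \<phi> \<xi>\<^sub>1 \<xi>\<^sub>2 \<le> ennreal (M * \<omega> (norm (\<xi>\<^sub>1 - \<xi>\<^sub>2)))"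
    using assms(3) by (auto simp: Lambda_circle_def)
  obtain C where C: "C > 0" and slow: "\<And>d. 0 < d \<Longrightarrow> d \<le> 2 \<Longrightarrow>
      ennreal d * (\<integral>\<^sup>+t\<in>{d..}. ennreal (\<omega> t / t\<^sup>2) \<partial>lborel) \<le> ennreal (C * \<omega> d)"
    using slow_majorant_bounded_range[OF assms(1), of 2] by auto
  define B where "B = 4 * M * (1 + pi\<^sup>2 * C)"
  have B0: "B > 0" using M C by (auto simp: B_def intro!: mult_pos_pos add_pos_nonneg)
  have w0: "\<omega> (norm z) \<ge> 0" for z :: complex by (intro majorantD[OF \<omega>]) auto
  \<comment> \<open>The displacement from a point to the nearest boundary point.\<close>
  have radial: "Lp_diff p ?F z \<zeta> \<le> ennreal (B * \<omega> (1 - norm z))"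
    if z: "norm z \<le> 1" and \<zeta>: "norm \<zeta> = 1" "norm (\<zeta> - z) = 1 - norm z" for z \<zeta>
  proof (cases "norm z = 1")
    case True
    then show ?thesis using \<zeta> p B0 by (simp add: Lp_diff_refl majorantD[OF \<omega>])
  next
    case False
    with z have z1: "norm z < 1" by simp
    show ?thesis unfolding B_def
    proof (rule Lp_diff_poisson_le_kernel[OF \<omega> p \<phi> _ M(2) \<zeta>(1) _ order_refl _ _ slow])
      show "poisson_kernel z (cis t) \<le> 4 * (1 - norm z) / (max (1 - norm z) (norm (cis t - \<zeta>) / 2))\<^sup>2" for t
      proof -
        have "poisson_kernel z (cis t) \<le> 2 * (1 - norm z) / (norm (cis t - z))\<^sup>2"
          by (rule poisson_kernel_le[OF z1])
        also have "\<dots> \<le> 4 * (1 - norm z) / (max (1 - norm z) (norm (cis t - \<zeta>) / 2))\<^sup>2"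
          using z1 max_le_norm_diff_inside[of "cis t", OF _ \<zeta>]
          by (intro frac_le power_mono zero_less_power) (auto simp: max_def)
        finally show ?thesis .
      qed
      \<comment> \<open>Required once for the circle integral and once for slowness.\<close>
      show "1 - norm z \<le> 2" using norm_ge_zero[of z] by linarith
      then show "1 - norm z \<le> 2" .
    qed (use z1 M C \<zeta> in \<open>simp_all add: poisson_kernel_nonneg continuous_on_poisson_kernel_cis
          poisson_boundary_diff_le[OF \<phi> _ \<zeta>(1)] del: times_divide_eq_left\<close>)
  qed
  have close: "Lp_diff p ?F z z' \<le> ennreal (B * \<omega> (norm (z - z')))"
    if z: "norm z < 1" and z': "norm z' < 1" and ne: "z \<noteq> z'" and d: "2 * norm (z - z') \<le> 1 - norm z"
      and \<zeta>: "norm \<zeta> = 1" "norm (\<zeta> - z) = 1 - norm z" for z z' \<zeta>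
    unfolding B_def
  proof (rule Lp_diff_poisson_le_kernel[OF \<omega> p \<phi> _ M(2) \<zeta>(1) _ _ _ _ slow])
    show "norm (z - z') \<le> 1 - norm z" using d norm_ge_zero[of "z - z'"] by linarith
    show "\<bar>poisson_kernel z (cis t) - poisson_kernel z' (cis t)\<bar>
        \<le> 4 * norm (z - z') / (max (1 - norm z) (norm (cis t - \<zeta>) / 2))\<^sup>2" for t
    proof -
      have "\<bar>poisson_kernel z (cis t) - poisson_kernel z' (cis t)\<bar> \<le> 4 * norm (z - z') / (norm (cis t - z))\<^sup>2"
        by (rule poisson_kernel_diff_le[OF _ z d]) simp
      also have "\<dots> \<le> 4 * norm (z - z') / (max (1 - norm z) (norm (cis t - \<zeta>) / 2))\<^sup>2"
        using z max_le_norm_diff_inside[of "cis t", OF _ \<zeta>]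
        by (intro frac_le power_mono zero_less_power) (auto simp: max_def)
      finally show ?thesis .
    qed
    \<comment> \<open>Required twice, as in the radial case.\<close>
    show "norm (z - z') \<le> 2" using d norm_ge_zero[of z] norm_ge_zero[of "z - z'"] by linarith
    then show "norm (z - z') \<le> 2" .
  qed (use z z' ne M C in \<open>auto intro!: continuous_intros continuous_on_poisson_kernel_cis
        poisson_interior_diff_le[OF \<phi>] simp del: times_divide_eq_left\<close>)
  have nearest: "\<exists>\<zeta>. norm \<zeta> = 1 \<and> norm (\<zeta> - z) = 1 - norm z" if "norm z \<le> 1" for z :: complex
  proof (cases "z = 0")
    case False
    have "sgn z - z = of_real (1 - norm z) * sgn z"
      using False by (simp add: sgn_eq field_simps)
    then have "norm (sgn z - z) = \<bar>1 - norm z\<bar> * norm (sgn z)"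
      by (simp only: norm_mult norm_of_real)
    with False that show ?thesis by (intro exI[of _ "sgn z"]) (simp add: norm_sgn)
  qed (auto intro!: exI[of _ 1])
  \<comment> \<open>The two factors \<open>4\<close> come from the quasi-triangle inequality, applied twice;
    \<open>2\<close>, \<open>6\<close> and \<open>3\<close> bound the depth of \<open>z\<^sub>1\<close>, the distance of the boundary points and
    the depth of \<open>z\<^sub>2\<close> in units of \<open>norm (z\<^sub>1 - z\<^sub>2)\<close>.\<close>
  define A where "A = 4 * (4 * (2 * B + 6 * M) + 3 * B)"
  have "Lp_diff p ?F z\<^sub>1 z\<^sub>2 \<le> ennreal (A * \<omega> (norm (z\<^sub>1 - z\<^sub>2)))"
    if z: "norm z\<^sub>1 \<le> 1" "norm z\<^sub>2 \<le> 1" for z\<^sub>1 z\<^sub>2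
  proof -
    let ?d = "norm (z\<^sub>1 - z\<^sub>2)"
    have AB: "B * \<omega> ?d \<le> A * \<omega> ?d" and A0: "A > 0"
      using B0 M by (auto simp: A_def intro!: mult_right_mono w0)
    obtain \<zeta>\<^sub>1 \<zeta>\<^sub>2 where \<zeta>: "norm \<zeta>\<^sub>1 = 1" "norm (\<zeta>\<^sub>1 - z\<^sub>1) = 1 - norm z\<^sub>1"
        "norm \<zeta>\<^sub>2 = 1" "norm (\<zeta>\<^sub>2 - z\<^sub>2) = 1 - norm z\<^sub>2"
      using nearest z by blast
    have z12: "norm z\<^sub>1 \<le> norm z\<^sub>2 + ?d" using norm_triangle_ineq2[of z\<^sub>1 z\<^sub>2] by simp
    have z21: "norm z\<^sub>2 \<le> norm z\<^sub>1 + ?d"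
      using norm_triangle_ineq2[of z\<^sub>2 z\<^sub>1] by (simp add: norm_minus_commute)
    consider "z\<^sub>1 = z\<^sub>2" | "z\<^sub>1 \<noteq> z\<^sub>2" "2 * ?d < 1 - norm z\<^sub>1" | "1 - norm z\<^sub>1 \<le> 2 * ?d"
      by linarith
    then show ?thesis
    proof cases
      case 1
      then show ?thesis using p by (simp add: Lp_diff_refl majorantD[OF \<omega>])
    next
      case 2
      have "norm z\<^sub>1 < 1" using 2(2) norm_ge_zero[of "z\<^sub>1 - z\<^sub>2"] by linarith
      moreover have "norm z\<^sub>2 < 1" using 2(2) z21 norm_ge_zero[of "z\<^sub>1 - z\<^sub>2"] by linarith
      ultimately have "Lp_diff p ?F z\<^sub>1 z\<^sub>2 \<le> ennreal (B * \<omega> ?d)"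
        using 2 \<zeta> by (intro close[of _ _ \<zeta>\<^sub>1]) auto
      then show ?thesis using AB by (rule Lp_diff_mono)
    next
      case 3
      have r1: "1 - norm z\<^sub>1 \<le> 2 * ?d" and r2: "1 - norm z\<^sub>2 \<le> 3 * ?d" using 3 z12 by linarith+
      have "norm (\<zeta>\<^sub>1 - \<zeta>\<^sub>2) \<le> norm (\<zeta>\<^sub>1 - z\<^sub>1) + norm (z\<^sub>1 - z\<^sub>2) + norm (\<zeta>\<^sub>2 - z\<^sub>2)"
        using norm_triangle_ineq4[of "\<zeta>\<^sub>1 - z\<^sub>1 + (z\<^sub>1 - z\<^sub>2)" "\<zeta>\<^sub>2 - z\<^sub>2"]
          norm_triangle_ineq[of "\<zeta>\<^sub>1 - z\<^sub>1" "z\<^sub>1 - z\<^sub>2"] by simp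
      then have r3: "norm (\<zeta>\<^sub>1 - \<zeta>\<^sub>2) \<le> 6 * ?d" using r1 r2 \<zeta> by simp
      have in1: "Lp_diff p ?F z\<^sub>1 \<zeta>\<^sub>1 \<le> ennreal (B * (2 * \<omega> ?d))"
        using B0 r1 z by (intro Lp_diff_mono[OF radial] mult_left_mono majorant_scale[OF \<omega>] \<zeta>) auto
      have circle: "Lp_diff p ?F \<zeta>\<^sub>1 \<zeta>\<^sub>2 \<le> ennreal (M * (6 * \<omega> ?d))"
      proof -
        have "Lp_diff p ?F \<zeta>\<^sub>1 \<zeta>\<^sub>2 = Lp_diff p \<phi> \<zeta>\<^sub>1 \<zeta>\<^sub>2"
          using \<zeta> by (simp add: Lp_diff_def poisson_extension_def norm_mult)
        then have "Lp_diff p ?F \<zeta>\<^sub>1 \<zeta>\<^sub>2 \<le> ennreal (M * \<omega> (norm (\<zeta>\<^sub>1 - \<zeta>\<^sub>2)))"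
          using M(2) \<zeta> by simp
        then show ?thesis
          using M r3 by (elim Lp_diff_mono) (auto intro!: mult_left_mono majorant_scale[OF \<omega>])
      qed
      have out: "Lp_diff p ?F z\<^sub>1 \<zeta>\<^sub>2 \<le> ennreal (4 * (B * (2 * \<omega> ?d) + M * (6 * \<omega> ?d)))"
        using z \<zeta> B0 M(1) w0 by (intro Lp_diff_triangle[OF p F _ _ _ in1 circle]) auto
      have in2: "Lp_diff p ?F \<zeta>\<^sub>2 z\<^sub>2 \<le> ennreal (B * (3 * \<omega> ?d))"
        unfolding Lp_diff_commute[of p ?F \<zeta>\<^sub>2]
        using B0 r2 z by (intro Lp_diff_mono[OF radial] mult_left_mono majorant_scale[OF \<omega>] \<zeta>) auto
      have "Lp_diff p ?F z\<^sub>1 z\<^sub>2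
          \<le> ennreal (4 * (4 * (B * (2 * \<omega> ?d) + M * (6 * \<omega> ?d)) + B * (3 * \<omega> ?d)))"
        using z \<zeta> B0 M(1) w0 by (intro Lp_diff_triangle[OF p F _ _ _ out in2]) auto
      also have "4 * (4 * (B * (2 * \<omega> ?d) + M * (6 * \<omega> ?d)) + B * (3 * \<omega> ?d)) = A * \<omega> ?d"
        by (simp add: A_def algebra_simps)
      finally show ?thesis .
    qed
  qed
  moreover have "A > 0" using B0 M by (simp add: A_def)
  ultimately show ?thesis using F unfolding Lambda_disk_def by auto
qed

end
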